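(* Let $q$ be a prime power and let $n,k,\kappa$ be integers with $n\geq k\geq 0$, $\kappa\ge 0$ and $\kappa\geq n-k$. Let $\tilde v_{n,k}=\mu_\kappa(\{X : \dim_{\mathbb{F}_q}(X\cap V_n)=k\})$. Then $$\tilde{v}_{n,k}=q^{(n-k)(n-k-1)/2-\kappa n}\,\frac{s_\kappa\, s_n}{s_{n-k}\,s_{\kappa-n+k}\,s_{k}}.$$
   Context: $\mathbb{F}_q$ is the field with $q$ elements and $s_j:=(q^j-1)(q^{j-1}-1)\cdots(q-1)$ for $j\ge 0$ (with $s_0=1$). $\mathrm{Sub}_{\mathbb{F}_q}(\bigoplus_{\mathbb{N}}\mathbb{F}_q)$ is the space of linear subspaces of the countable discrete vector space $\bigoplus_{\mathbb{N}}\mathbb{F}_q$ (topology induced from $\{0,1\}^{\bigoplus_{\mathbb{N}}\mathbb{F}_q}$). For an integer $\kappa\ge 0$, $\mu_\kappa$ is the Borel probability measure on this space that is the law of $\mathrm{Ker}(h)$, where $h$ is a random element of the compact group $\mathrm{Hom}_{\mathbb{F}_q}(\bigoplus_{\mathbb{N}}\mathbb{F}_q,\mathbb{F}_q^\kappa)$ of linear maps (topology of pointwise convergence) distributed according to normalized Haar measure. $V_n=\bigoplus_{1}^n\mathbb{F}_q\subset\bigoplus_{\mathbb{N}}\mathbb{F}_q$ is the span of the first $n$ standard basis vectors. *)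

theory Defs
  imports "HOL-Probability.Probability" "HOL-Library.Poly_Mapping"
begin

text \<open>
  The finite field is a type \<open>'a\<close> of sort \<open>{field, finite}\<close>, so that \<open>q = CARD('a)\<close>.
  The countable direct sum of copies of \<open>'a\<close> is the type \<open>nat \<Rightarrow>\<^sub>0 'a\<close> of finitely supported
  functions, with coordinates (and hence standard basis vectors) indexed from \<open>0\<close>.
\<close>

definition scale :: "'a::field \<Rightarrow> (nat \<Rightarrow>\<^sub>0 'a) \<Rightarrow> (nat \<Rightarrow>\<^sub>0 'a)" where
  "scale c x = Poly_Mapping.map (\<lambda>a. c * a) x"

lemma lookup_scale: "Poly_Mapping.lookup (scale c x) i = c * Poly_Mapping.lookup x i"
  by (simp add: scale_def Poly_Mapping.map.rep_eq when_def)

lemma vector_space_scale: "vector_space (scale :: 'a::field \<Rightarrow> _)"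
  by unfold_locales
     (auto intro!: poly_mapping_eqI simp: lookup_scale lookup_add algebra_simps)

definition basis_vec :: "nat \<Rightarrow> (nat \<Rightarrow>\<^sub>0 'a::field)" where
  "basis_vec i = Poly_Mapping.single i 1"

definition V :: "nat \<Rightarrow> (nat \<Rightarrow>\<^sub>0 'a::field) set" where
  "V n = module.span scale (basis_vec ` {..<n})"

lemma V_eq: "V n = {x :: nat \<Rightarrow>\<^sub>0 'a::field. Poly_Mapping.keys x \<subseteq> {..<n}}"
proof -
  interpret vector_space "scale :: 'a \<Rightarrow> _" by (rule vector_space_scale)
  have sub: "subspace {x :: nat \<Rightarrow>\<^sub>0 'a. Poly_Mapping.keys x \<subseteq> {..<n}}"
  proof (rule subspaceI)
    fix x y :: "nat \<Rightarrow>\<^sub>0 'a" assume "x \<in> {x. Poly_Mapping.keys x \<subseteq> {..<n}}" "y \<in> {x. Poly_Mapping.keys x \<subseteq> {..<n}}"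
    then show "x + y \<in> {x. Poly_Mapping.keys x \<subseteq> {..<n}}"
      using Poly_Mapping.keys_add[of x y] by blast
  next
    fix c and x :: "nat \<Rightarrow>\<^sub>0 'a" assume "x \<in> {x. Poly_Mapping.keys x \<subseteq> {..<n}}"
    moreover have "Poly_Mapping.keys (scale c x) \<subseteq> Poly_Mapping.keys x"
      by (auto simp: in_keys_iff lookup_scale)
    ultimately show "scale c x \<in> {x. Poly_Mapping.keys x \<subseteq> {..<n}}" by blast
  qed simp
  show ?thesis
  proof
    show "V n \<subseteq> {x :: nat \<Rightarrow>\<^sub>0 'a. Poly_Mapping.keys x \<subseteq> {..<n}}"
      unfolding V_def by (rule span_minimal[OF _ sub]) (auto simp: basis_vec_def)
  next
    show "{x :: nat \<Rightarrow>\<^sub>0 'a. Poly_Mapping.keys x \<subseteq> {..<n}} \<subseteq> V n"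
    proof
      fix x :: "nat \<Rightarrow>\<^sub>0 'a" assume "x \<in> {x. Poly_Mapping.keys x \<subseteq> {..<n}}"
      then have k: "Poly_Mapping.keys x \<subseteq> {..<n}" by simp
      have "x = (\<Sum>i<n. scale (Poly_Mapping.lookup x i) (basis_vec i))"
      proof (rule poly_mapping_eqI)
        fix j
        have "Poly_Mapping.lookup (\<Sum>i<n. scale (Poly_Mapping.lookup x i) (basis_vec i)) j
            = (\<Sum>i<n. if i = j then Poly_Mapping.lookup x j else 0)"
          unfolding lookup_sum lookup_scale basis_vec_def lookup_single when_def
          by (rule sum.cong) auto
        also have "\<dots> = Poly_Mapping.lookup x j"
          using k by (auto simp: in_keys_iff subset_iff)
        finally show "Poly_Mapping.lookup x j = Poly_Mapping.lookup (\<Sum>i<n. scale (Poly_Mapping.lookup x i) (basis_vec i)) j" ..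
      qed
      also have "\<dots> \<in> V n"
        unfolding V_def by (intro span_sum span_scale span_base) auto
      finally show "x \<in> V n" .
    qed
  qed
qed

definition borel_of_topology :: "'b topology \<Rightarrow> 'b measure" where
  "borel_of_topology T = sigma (topspace T) {U. openin T U}"

text \<open>
  A set of vectors is identified with its indicator function, a point of the product of
  copies of the discrete two-point space.
\<close>

definition Sub_topology :: "(nat \<Rightarrow>\<^sub>0 'a::field) set topology" where
  "Sub_topology = pullback_topology {X. module.subspace scale X} (\<lambda>X x. x \<in> X)
     (product_topology (\<lambda>_. discrete_topology (UNIV :: bool set)) UNIV)"

text \<open>The target space of dimension \<open>\<kappa>\<close> is realised as \<open>V \<kappa>\<close>; by \<open>V_eq\<close> it consists of the
  coordinate vectors of length \<open>\<kappa>\<close> extended by zero.\<close>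

definition Hom :: "nat \<Rightarrow> ((nat \<Rightarrow>\<^sub>0 'a::field) \<Rightarrow> (nat \<Rightarrow>\<^sub>0 'a)) set" where
  "Hom \<kappa> = {h. Vector_Spaces.linear scale scale h \<and> (\<forall>x. h x \<in> V \<kappa>)}"

definition Hom_topology :: "nat \<Rightarrow> ((nat \<Rightarrow>\<^sub>0 'a::field) \<Rightarrow> (nat \<Rightarrow>\<^sub>0 'a)) topology" where
  "Hom_topology \<kappa> = subtopology (product_topology (\<lambda>_. discrete_topology (V \<kappa>)) UNIV) (Hom \<kappa>)"

text \<open>
  Normalized Haar measure as the unique translation-invariant Borel probability measure.
  \<open>Hom \<kappa>\<close> is compact and metrizable (the source is countable), so every finite Borel measure
  on it is regular and regularity need not be demanded.
\<close>

definition is_normalized_Haar ::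
  "nat \<Rightarrow> ((nat \<Rightarrow>\<^sub>0 'a::{field,finite}) \<Rightarrow> (nat \<Rightarrow>\<^sub>0 'a)) measure \<Rightarrow> bool" where
  "is_normalized_Haar \<kappa> M \<longleftrightarrow>
     prob_space M \<and> sets M = sets (borel_of_topology (Hom_topology \<kappa>)) \<and>
     (\<forall>g \<in> Hom \<kappa>. \<forall>A \<in> sets M. emeasure M ((\<lambda>h x. g x + h x) ` A) = emeasure M A)"

definition Haar :: "nat \<Rightarrow> ((nat \<Rightarrow>\<^sub>0 'a::{field,finite}) \<Rightarrow> (nat \<Rightarrow>\<^sub>0 'a)) measure" where
  "Haar \<kappa> = (THE M. is_normalized_Haar \<kappa> M)"

definition Ker :: "((nat \<Rightarrow>\<^sub>0 'a::field) \<Rightarrow> (nat \<Rightarrow>\<^sub>0 'a)) \<Rightarrow> (nat \<Rightarrow>\<^sub>0 'a) set" where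
  "Ker h = {x. h x = 0}"

definition \<mu> :: "nat \<Rightarrow> (nat \<Rightarrow>\<^sub>0 'a::{field,finite}) set measure" where
  "\<mu> \<kappa> = distr (Haar \<kappa>) (borel_of_topology Sub_topology) Ker"

definition s :: "nat \<Rightarrow> nat \<Rightarrow> real" where
  "s q j = (\<Prod>i=1..j. (real q ^ i - 1))"

end

theory Submission
  imports Defs
begin

text \<open>
  A homomorphism \<open>h\<close> is determined by its values on the standard basis, and fixing the first \<open>n\<close>
  of them gives a cylinder set. The \<open>q ^ (\<kappa> * n)\<close> nonempty cylinders of level \<open>n\<close> are translates
  of each other, so normalized Haar measure is the product of uniform measures, and
  \<open>h (basis_vec 0), ..., h (basis_vec (n - 1))\<close> is a uniformly random \<open>n\<close>-tuple in a space
  of dimension \<open>\<kappa>\<close>. By rank-nullity \<open>Ker h \<inter> V n\<close> has dimension \<open>k\<close> iff this tuple has rank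
  \<open>r = n - k\<close>. The number \<open>T n r\<close> of such tuples satisfies
  \<open>T (n + 1) r = q ^ r * T n r + (q ^ \<kappa> - q ^ (r - 1)) * T n (r - 1)\<close>, because the
  additional vector either lies in the span of the previous ones or raises the rank.
\<close>

section \<open>Counting tuples of given rank\<close>

text \<open>Rank r is encoded by the span having q^r elements: cardinalities multiply when a vector
  is adjoined and in rank-nullity, so counting never has to pass through \<open>dim\<close>.
  Extensional functions make a tuple the same as its n entries, so the set is finite for finite
  \<open>W\<close>.\<close>

definition tuples_of_rank ::
  "('a::field \<Rightarrow> 'b::ab_group_add \<Rightarrow> 'b) \<Rightarrow> 'b set \<Rightarrow> nat \<Rightarrow> nat \<Rightarrow> (nat \<Rightarrow> 'b) set" where
  "tuples_of_rank sc W n r =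
     {v \<in> {..<n} \<rightarrow>\<^sub>E W. card (module.span sc (v ` {..<n})) = card (UNIV :: 'a set) ^ r}"

context vector_space
begin

text \<open>The elements of the larger span are \<open>scale c x + y\<close> for exactly one pair of
  a scalar c and y in \<open>span S\<close>: two representations with different scalars could be
  solved for x, which would then lie in \<open>span S\<close>.\<close>

lemma card_span_insert:
  assumes "x \<notin> span S"
  shows "card (span (insert x S)) = card (UNIV :: 'a set) * card (span S)"
proof -
  have "bij_betw (\<lambda>(c, y). scale c x + y) (UNIV \<times> span S) (span (insert x S))"
  proof (rule bij_betw_imageI)
    show "inj_on (\<lambda>(c, y). scale c x + y) (UNIV \<times> span S)"
    proof (rule inj_onI, clarify)
      fix c d y z assume y: "y \<in> span S" and z: "z \<in> span S"
        and eq: "scale c x + y = scale d x + z"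
      have diff: "scale (c - d) x = z - y"
        using eq by (simp add: scale_left_diff_distrib algebra_simps)
      have "c = d"
      proof (rule ccontr)
        assume "c \<noteq> d"
        then have "x = scale (inverse (c - d)) (z - y)"
          by (simp flip: diff)
        then show False
          using assms y z by (metis span_diff span_scale)
      qed
      then show "c = d \<and> y = z" using eq by simp
    qed
    show "(\<lambda>(c, y). scale c x + y) ` (UNIV \<times> span S) = span (insert x S)"
    proof (intro equalityI subsetI)
      fix z assume "z \<in> span (insert x S)"
      then obtain k where "z - scale k x \<in> span S"
        using span_breakdown_eq by blast
      then show "z \<in> (\<lambda>(c, y). scale c x + y) ` (UNIV \<times> span S)"
        by (intro image_eqI[of _ _ "(k, z - scale k x)"]) auto
    next
      fix z assume "z \<in> (\<lambda>(c, y). scale c x + y) ` (UNIV \<times> span S)"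
      then obtain c y where "z = scale c x + y" "y \<in> span S" by auto
      then have "z - scale c x \<in> span S" by simp
      then show "z \<in> span (insert x S)"
        using span_breakdown_eq by blast
    qed
  qed
  from bij_betw_same_card[OF this] show ?thesis
    by (simp add: card_cartesian_product)
qed

lemma card_span_independent:
  assumes "finite B" "independent B"
  shows "card (span B) = card (UNIV :: 'a set) ^ card B"
  using assms by (induction B rule: finite_induct) (auto simp: card_span_insert independent_insert)

text \<open>This is the passage from dimensions, in which the theorem is phrased, to cardinalities,
  in which ranks are counted.\<close>

lemma card_subspace:
  assumes "subspace X" "finite X"
  shows "card X = card (UNIV :: 'a set) ^ dim X"
proof -
  obtain B where B: "B \<subseteq> X" "independent B" "X \<subseteq> span B" "card B = dim X"
    using basis_exists by blast
  then have "span B = X" using assms span_minimal by blast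
  moreover have "finite B" using B assms finite_subset by blast
  ultimately show ?thesis using card_span_independent B by metis
qed

lemma finite_tuples_of_rank: "finite W \<Longrightarrow> finite (tuples_of_rank scale W n r)"
  by (simp add: tuples_of_rank_def finite_PiE)

lemma card_tuples_of_rank_0:
  assumes "card (UNIV :: 'a set) > 1"
  shows "card (tuples_of_rank scale W 0 r) = (if r = 0 then 1 else 0)"
proof -
  have "card (UNIV :: 'a set) ^ r = Suc 0 \<longleftrightarrow> r = 0"
    using assms by (metis One_nat_def nat_power_eq_Suc_0_iff less_not_refl)
  then show ?thesis
    by (simp add: tuples_of_rank_def eq_commute[of "Suc 0"])
qed

text \<open>A tuple of length n + 1 is a pair of its first n entries and a last vector, and is
  counted according to whether that vector lies in the span of the others. The number of choices
  outside the span is a difference, so the recurrence is stated over the reals.\<close>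

lemma card_tuples_of_rank_Suc:
  assumes W: "subspace W" "finite W" and q: "card (UNIV :: 'a set) > 1"
  shows "real (card (tuples_of_rank scale W (Suc n) r)) =
    real (card (UNIV :: 'a set)) ^ r * card (tuples_of_rank scale W n r) +
    (if r = 0 then 0
     else (real (card W) - real (card (UNIV :: 'a set)) ^ (r - 1)) * card (tuples_of_rank scale W n (r - 1)))"
proof -
  let ?q = "card (UNIV :: 'a set)"
  let ?upd = "\<lambda>(v, w). v(n := w) :: nat \<Rightarrow> 'b"
  let ?sp = "\<lambda>v. span (v ` {..<n})"
  \<comment> \<open>\<open>A\<close> collects the pairs whose last vector keeps the rank,
    \<open>B\<close> those where it raises the rank to r. The guard in \<open>B\<close> matters: at
    r = 0 the truncated \<open>r - 1\<close> is 0, and \<open>B\<close> would wrongly collect tuples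
    of rank 1.\<close>
  define A where "A = (SIGMA v:tuples_of_rank scale W n r. ?sp v)"
  define B where "B = (SIGMA v:(if r = 0 then {} else tuples_of_rank scale W n (r - 1)). W - ?sp v)"
  have sp: "?sp v \<subseteq> W" if "v \<in> {..<n} \<rightarrow>\<^sub>E W" for v
    using that W(1) by (intro span_minimal) auto
  have finsp: "finite (?sp v)" if "v \<in> {..<n} \<rightarrow>\<^sub>E W" for v
    using sp[OF that] W(2) finite_subset by blast
  have im: "(v(n := w)) ` {..<Suc n} = insert w (v ` {..<n})" for v and w :: 'b
    by (auto simp: lessThan_Suc)
  have mem: "v(n := w) \<in> tuples_of_rank scale W (Suc n) r \<longleftrightarrow> (v, w) \<in> A \<union> B"
    if v: "v \<in> {..<n} \<rightarrow>\<^sub>E W" and w: "w \<in> W" for v w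
  proof -
    have PiE: "v(n := w) \<in> {..<Suc n} \<rightarrow>\<^sub>E W"
      using v w by (auto simp: PiE_iff extensional_def less_Suc_eq)
    have iff: "v(n := w) \<in> tuples_of_rank scale W (Suc n) r \<longleftrightarrow> card (span (insert w (v ` {..<n}))) = ?q ^ r"
      unfolding tuples_of_rank_def mem_Collect_eq im using PiE by simp
    show ?thesis
    proof (cases "w \<in> ?sp v")
      case True
      then have "span (insert w (v ` {..<n})) = ?sp v"
        by (simp add: span_redundant)
      then show ?thesis
        using iff True v by (auto simp: tuples_of_rank_def A_def B_def)
    next
      case False
      have "card (?sp v) > 0"
        using finsp[OF v] span_zero by (auto simp: card_gt_0_iff)
      \<comment> \<open>This settles r = 0: a tuple with a vector outside the previous span never
        has a span of size q^0.\<close>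
      then have "?q * card (?sp v) \<noteq> 1" using q by auto
      then have "?q * card (?sp v) = ?q ^ r \<longleftrightarrow> r \<noteq> 0 \<and> card (?sp v) = ?q ^ (r - 1)"
        using q by (cases r) auto
      moreover have "(v, w) \<in> A \<union> B \<longleftrightarrow> r \<noteq> 0 \<and> card (?sp v) = ?q ^ (r - 1)"
        using False v w by (simp add: tuples_of_rank_def A_def B_def)
      ultimately show ?thesis
        unfolding iff card_span_insert[OF False] by blast
    qed
  qed
  have tup: "v \<in> {..<n} \<rightarrow>\<^sub>E W" if "v \<in> tuples_of_rank scale W n j" for v j
    using that by (simp add: tuples_of_rank_def)
  have "A \<subseteq> ({..<n} \<rightarrow>\<^sub>E W) \<times> W"
    unfolding A_def using tup sp by blast
  moreover have "B \<subseteq> ({..<n} \<rightarrow>\<^sub>E W) \<times> W"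
    unfolding B_def by (clarsimp split: if_splits simp: tup)
  ultimately have sub: "A \<union> B \<subseteq> ({..<n} \<rightarrow>\<^sub>E W) \<times> W" by blast
  have img: "tuples_of_rank scale W (Suc n) r = ?upd ` (A \<union> B)"
  proof (intro equalityI subsetI)
    fix u assume u: "u \<in> tuples_of_rank scale W (Suc n) r"
    then have uW: "u \<in> {..<Suc n} \<rightarrow>\<^sub>E W" by (simp add: tuples_of_rank_def)
    have in_W: "u i \<in> W" if "i < Suc n" for i
      using PiE_mem[OF uW] that by simp
    have undef: "u i = undefined" if "\<not> i < Suc n" for i
      using PiE_arb[OF uW] that by simp
    have res: "restrict u {..<n} \<in> {..<n} \<rightarrow>\<^sub>E W"
      by (intro restrict_PiE_iff[THEN iffD2] ballI in_W) simp
    have eq: "(restrict u {..<n})(n := u n) = u"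
      by (rule ext) (simp add: undef restrict_def)
    show "u \<in> ?upd ` (A \<union> B)"
      using mem[OF res in_W[of n]] u
      by (intro image_eqI[of _ _ "(restrict u {..<n}, u n)"]) (simp_all add: eq)
  next
    fix u assume "u \<in> ?upd ` (A \<union> B)"
    then obtain v w where u: "u = v(n := w)" and vw: "(v, w) \<in> A \<union> B" by auto
    then have "v \<in> {..<n} \<rightarrow>\<^sub>E W" "w \<in> W" using sub by blast+
    with mem u vw show "u \<in> tuples_of_rank scale W (Suc n) r" by simp
  qed
  have "inj_on ?upd (({..<n} \<rightarrow>\<^sub>E W) \<times> W)"
  proof (rule inj_onI, clarify)
    fix v w v' w' assume v: "v \<in> {..<n} \<rightarrow>\<^sub>E W" "v' \<in> {..<n} \<rightarrow>\<^sub>E W" and eq: "v(n := w) = v'(n := w')"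
    \<comment> \<open>The update overwrites the value at n, but an extensional \<open>v\<close> is
      \<open>undefined\<close> there, so nothing is lost.\<close>
    have "v i = v' i" for i
      using PiE_arb[OF v(1), of n] PiE_arb[OF v(2), of n] fun_cong[OF eq, of i] by (cases "i = n") simp_all
    then show "v = v' \<and> w = w'" using fun_cong[OF eq, of n] by auto
  qed
  then have "card (tuples_of_rank scale W (Suc n) r) = card (A \<union> B)"
    unfolding img by (intro card_image) (use sub inj_on_subset in blast)
  also have "\<dots> = card A + card B"
  proof (rule card_Un_disjoint)
    have "finite (({..<n} \<rightarrow>\<^sub>E W) \<times> W)" using W by (simp add: finite_PiE)
    then show "finite A" "finite B" using sub by (meson Un_subset_iff finite_subset)+
  qed (auto simp: A_def B_def)
  finally have "real (card (tuples_of_rank scale W (Suc n) r)) = real (card A) + real (card B)" by simp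
  moreover have "real (card A) = real ?q ^ r * card (tuples_of_rank scale W n r)"
  proof -
    have "card A = (\<Sum>v\<in>tuples_of_rank scale W n r. card (?sp v))"
      unfolding A_def using finite_tuples_of_rank[OF W(2)] finsp
      by (intro card_SigmaI) (auto simp: tuples_of_rank_def)
    also have "\<dots> = (\<Sum>v\<in>tuples_of_rank scale W n r. ?q ^ r)"
      by (rule sum.cong) (auto simp: tuples_of_rank_def)
    finally show ?thesis by simp
  qed
  moreover have "real (card B) = (real (card W) - real ?q ^ (r - 1)) * card (tuples_of_rank scale W n (r - 1))"
    if "r \<noteq> 0"
  proof -
    have "card B = (\<Sum>v\<in>tuples_of_rank scale W n (r - 1). card (W - ?sp v))"
      unfolding B_def using finite_tuples_of_rank[OF W(2)] W that
      by (simp add: card_SigmaI)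
    then have "real (card B) = (\<Sum>v\<in>tuples_of_rank scale W n (r - 1). real (card (W - ?sp v)))"
      by simp
    also have "\<dots> = (\<Sum>v\<in>tuples_of_rank scale W n (r - 1). real (card W) - real ?q ^ (r - 1))"
    proof (rule sum.cong[OF refl])
      fix v assume v: "v \<in> tuples_of_rank scale W n (r - 1)"
      then have vW: "v \<in> {..<n} \<rightarrow>\<^sub>E W" and c: "card (?sp v) = ?q ^ (r - 1)"
        by (auto simp: tuples_of_rank_def)
      have "card (W - ?sp v) = card W - card (?sp v)"
        using sp[OF vW] finsp[OF vW] by (simp add: card_Diff_subset)
      moreover have "card (?sp v) \<le> card W"
        using sp[OF vW] W(2) by (simp add: card_mono)
      ultimately show "real (card (W - ?sp v)) = real (card W) - real ?q ^ (r - 1)"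
        by (simp add: of_nat_diff c)
    qed
    finally show ?thesis by simp
  qed
  moreover have "card B = 0" if "r = 0" using that by (simp add: B_def)
  ultimately show ?thesis by auto
qed

end

section \<open>Solving the recurrence in terms of s_j\<close>

lemma s_0 [simp]: "s q 0 = 1"
  by (simp add: s_def)

lemma s_Suc: "s q (Suc j) = s q j * (real q ^ Suc j - 1)"
  by (simp add: s_def)

lemma s_pos: "q > 1 \<Longrightarrow> s q j > 0"
  by (auto simp: s_def intro!: prod_pos one_less_power)

text \<open>The quotient s_n / (s_r s_{n-r}) is the Gaussian binomial counting the possible kernels
  of a rank r map from an n-dimensional space, and the product counts the injective maps from the
  r-dimensional quotient into \<open>W\<close>. The proof only solves the recurrence by induction on
  n, with denominators cleared. The vanishing for r > n is part of the induction because the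
  recurrence at r = n + 1 refers to it.\<close>

lemma (in vector_space) card_tuples_of_rank:
  fixes q :: nat
  assumes W: "subspace W" "finite W" and q: "q = card (UNIV :: 'a set)" "q > 1"
  shows "(r > n \<longrightarrow> card (tuples_of_rank scale W n r) = 0) \<and>
    (r \<le> n \<longrightarrow> real (card (tuples_of_rank scale W n r)) * s q r * s q (n - r)
      = s q n * (\<Prod>i<r. real (card W) - real q ^ i))"
proof (induction n arbitrary: r)
  case 0
  then show ?case using card_tuples_of_rank_0[of W r] q by auto
next
  case (Suc n)
  note rec = card_tuples_of_rank_Suc[OF W, of n r, folded q(1), OF q(2)]
  show ?case
  proof (cases r)
    case 0
    then have "real (card (tuples_of_rank scale W (Suc n) r)) = card (tuples_of_rank scale W n 0)"
      using rec by simp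
    moreover have "real (card (tuples_of_rank scale W n 0)) = 1"
      using Suc.IH[of 0] s_pos[OF q(2), of n] by simp
    ultimately show ?thesis using 0 by simp
  next
    case (Suc r')
    let ?T = "\<lambda>n r. real (card (tuples_of_rank scale W n r))"
    let ?F = "\<lambda>r. \<Prod>i<r. real (card W) - real q ^ i"
    have rec': "?T (Suc n) r = real q ^ r * ?T n r + (real (card W) - real q ^ r') * ?T n r'"
      using rec Suc by simp
    \<comment> \<open>For \<open>r' > n\<close> both terms of the recurrence vanish. For
      \<open>r' = n\<close> only the second survives, and \<open>n - r\<close> would be truncated,
      so this full-rank case is kept apart from the generic one.\<close>
    consider "r' > n" | "r' = n" | "r' < n" by linarith
    then show ?thesis
    proof cases
      case 1
      then show ?thesis using rec' Suc Suc.IH[of r] Suc.IH[of r'] by simp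
    next
      case 2
      have "?T (Suc n) r * s q r = (real q ^ r - 1) * (real (card W) - real q ^ r') * (?T n r' * s q r')"
        using rec' Suc.IH[of r] Suc 2 by (simp add: s_Suc)
      also have "?T n r' * s q r' = s q n * ?F r'"
        using Suc.IH[of r'] 2 by simp
      finally show ?thesis using Suc 2 by (simp add: s_Suc algebra_simps)
    next
      case 3
      then obtain d where d: "n = Suc (r' + d)" by (metis less_iff_Suc_add)
      have "?T (Suc n) r * s q r * s q (Suc d) =
        real q ^ r * (real q ^ Suc d - 1) * (?T n r * s q r * s q d)
        + (real (card W) - real q ^ r') * (real q ^ r - 1) * (?T n r' * s q r' * s q (Suc d))"
        unfolding rec' unfolding Suc s_Suc by algebra
      also have "?T n r * s q r * s q d = s q n * ?F r"
        using Suc.IH[of r] Suc d by simp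
      also have "?T n r' * s q r' * s q (Suc d) = s q n * ?F r'"
        using Suc.IH[of r'] d by simp
      \<comment> \<open>The q-Pascal identity: \<open>?F r\<close> contains the factor |W| -
        q^(r-1), and q^r (q^(d+1) - 1) + (q^r - 1) = q^(n+1) - 1 since n = r + d.\<close>
      also have "real q ^ r * (real q ^ Suc d - 1) * (s q n * ?F r)
          + (real (card W) - real q ^ r') * (real q ^ r - 1) * (s q n * ?F r')
        = s q n * (real q ^ Suc n - 1) * ?F r"
        using Suc d by (simp add: algebra_simps power_add)
      finally show ?thesis using Suc d by (simp add: s_Suc)
    qed
  qed
qed

text \<open>Write q^\<kappa> - q^i = q^i (q^(\<kappa>-i) - 1). The powers of q multiply to the
  exponent 0 + ... + (r - 1) = r(r - 1)/2, and the other factors are the top r factors of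
  s_\<kappa>.\<close>

lemma prod_power_diff_eq_s:
  assumes "q > 1" "r \<le> \<kappa>"
  shows "(\<Prod>i<r. real q ^ \<kappa> - real q ^ i) * s q (\<kappa> - r)
    = real q powr (real r * (real r - 1) / 2) * s q \<kappa>"
  using assms(2)
proof (induction r)
  case 0
  then show ?case using assms by simp
next
  case (Suc r)
  then obtain d where d: "\<kappa> = Suc (r + d)" by (metis Suc_le_eq less_iff_Suc_add)
  have "(\<Prod>i<Suc r. real q ^ \<kappa> - real q ^ i) * s q (\<kappa> - Suc r)
      = real q ^ r * ((\<Prod>i<r. real q ^ \<kappa> - real q ^ i) * s q (\<kappa> - r))"
    using d by (simp add: s_Suc power_add algebra_simps)
  also have "\<dots> = real q powr real r * (real q powr (real r * (real r - 1) / 2) * s q \<kappa>)"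
    using Suc assms by (simp add: powr_realpow)
  also have "\<dots> = real q powr (real r + real r * (real r - 1) / 2) * s q \<kappa>"
    by (simp add: powr_add)
  also have "real r + real r * (real r - 1) / 2 = real (Suc r) * (real (Suc r) - 1) / 2"
    by (simp add: field_simps)
  finally show ?case .
qed


section \<open>Homomorphisms and cylinder sets\<close>

text \<open>Rank-nullity in multiplicative form. The map \<open>?g\<close> picks a preimage in
  \<open>S\<close> for each image point, and every z in \<open>S\<close> splits uniquely into the
  kernel part \<open>z - ?g (f z)\<close> and the chosen representative
  \<open>?g (f z)\<close>.\<close>

lemma (in Vector_Spaces.linear) card_kernel_mult_card_image:
  assumes "vs1.subspace S"
  shows "card {x \<in> S. f x = 0} * card (f ` S) = card S"
proof -
  let ?g = "inv_into S f"
  have g: "?g y \<in> S" "f (?g y) = y" if "y \<in> f ` S" for y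
    using that by (auto intro: inv_into_into f_inv_into_f)
  have "bij_betw (\<lambda>(x, y). x + ?g y) ({x \<in> S. f x = 0} \<times> f ` S) S"
  proof (rule bij_betw_byWitness[where f' = "\<lambda>z. (z - ?g (f z), f z)"])
    show "(\<lambda>(x, y). x + ?g y) ` ({x \<in> S. f x = 0} \<times> f ` S) \<subseteq> S"
    proof clarify
      fix x z assume "x \<in> S" "z \<in> S"
      then show "x + ?g (f z) \<in> S" using g(1)[of "f z"] assms by (simp add: vs1.subspace_add)
    qed
    show "(\<lambda>z. (z - ?g (f z), f z)) ` S \<subseteq> {x \<in> S. f x = 0} \<times> f ` S"
    proof (rule image_subsetI)
      fix z assume "z \<in> S"
      then show "(z - ?g (f z), f z) \<in> {x \<in> S. f x = 0} \<times> f ` S"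
        using g[of "f z"] assms by (simp add: vs1.subspace_diff diff)
    qed
    show "\<forall>p\<in>{x \<in> S. f x = 0} \<times> f ` S. (\<lambda>z. (z - ?g (f z), f z)) ((\<lambda>(x, y). x + ?g y) p) = p"
    proof
      fix p assume p: "p \<in> {x \<in> S. f x = 0} \<times> f ` S"
      obtain x y where xy: "p = (x, y)" by fastforce
      with p have x: "f x = 0" and y: "y \<in> f ` S" by simp_all
      have "f (x + ?g y) = y" unfolding add x g(2)[OF y] by simp
      then show "(\<lambda>z. (z - ?g (f z), f z)) ((\<lambda>(x, y). x + ?g y) p) = p" by (simp add: xy)
    qed
    show "\<forall>z\<in>S. (\<lambda>(x, y). x + ?g y) ((\<lambda>z. (z - ?g (f z), f z)) z) = z" by simp
  qed
  from bij_betw_same_card[OF this] show ?thesis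
    by (simp add: card_cartesian_product)
qed

section \<open>Coordinates and linear maps on the direct sum\<close>

interpretation fs: vector_space "scale :: 'a::field \<Rightarrow> _"
  by (rule vector_space_scale)

interpretation fsp: vector_space_pair "scale :: 'a::field \<Rightarrow> _" "scale :: 'a \<Rightarrow> _"
  ..

lemma lookup_basis_vec: "Poly_Mapping.lookup (basis_vec i) j = (if i = j then 1 else 0)"
  by (simp add: basis_vec_def lookup_single when_def)

lemma inj_basis_vec: "inj (basis_vec :: nat \<Rightarrow> (nat \<Rightarrow>\<^sub>0 'a::field))"
proof (rule injI)
  fix i j assume "(basis_vec i :: nat \<Rightarrow>\<^sub>0 'a) = basis_vec j"
  then have "Poly_Mapping.lookup (basis_vec i :: nat \<Rightarrow>\<^sub>0 'a) i = Poly_Mapping.lookup (basis_vec j) i"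
    by simp
  then show "i = j" by (simp add: lookup_basis_vec split: if_splits)
qed

lemma subspace_V: "fs.subspace (V n)"
  by (simp add: V_def)

lemma zero_in_V [simp]: "0 \<in> V n"
  by (simp add: V_eq)

lemma card_V: "card (V n :: (nat \<Rightarrow>\<^sub>0 'a::{field,finite}) set) = CARD('a) ^ n"
proof (induction n)
  case 0
  then show ?case by (simp add: V_def)
next
  case (Suc n)
  have "(basis_vec n :: nat \<Rightarrow>\<^sub>0 'a) \<notin> V n"
    by (auto simp: V_eq basis_vec_def)
  then have "(basis_vec n :: nat \<Rightarrow>\<^sub>0 'a) \<notin> fs.span (basis_vec ` {..<n})"
    by (simp add: V_def)
  then show ?case
    using Suc by (simp add: V_def lessThan_Suc fs.card_span_insert)
qed

lemma finite_V [simp]: "finite (V n :: (nat \<Rightarrow>\<^sub>0 'a::{field,finite}) set)"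
  by (rule card_ge_0_finite) (simp add: card_V)

lemma V_mono: "m \<le> n \<Longrightarrow> V m \<subseteq> V n"
  by (auto simp: V_eq)

lemma ex_V: "\<exists>n. x \<in> V n"
proof -
  obtain n where "Poly_Mapping.keys x \<subseteq> {..<n}"
    using finite_keys[of x] finite_nat_iff_bounded by blast
  then show ?thesis by (auto simp: V_eq)
qed

lemma finite_subset_V:
  assumes "finite F"
  shows "\<exists>n. F \<subseteq> V n"
  using assms
proof induction
  case (insert x F)
  then obtain m n where "F \<subseteq> V m" "x \<in> V n" using ex_V by blast
  then have "insert x F \<subseteq> V (max m n)"
    using V_mono[of m "max m n"] V_mono[of n "max m n"] by auto
  then show ?case ..
qed auto

text \<open>Coordinate i vanishes on all other basis vectors, hence on their span, but not on
  \<open>basis_vec i\<close>.\<close>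

lemma independent_basis_vec: "fs.independent (range (basis_vec :: nat \<Rightarrow> (nat \<Rightarrow>\<^sub>0 'a::field)))"
  unfolding fs.dependent_def
proof clarify
  fix i assume i: "(basis_vec i :: nat \<Rightarrow>\<^sub>0 'a) \<in> fs.span (range basis_vec - {basis_vec i})"
  have "fs.span (range basis_vec - {basis_vec i}) \<subseteq> {x :: nat \<Rightarrow>\<^sub>0 'a. Poly_Mapping.lookup x i = 0}"
  proof (rule fs.span_minimal)
    show "fs.subspace {x :: nat \<Rightarrow>\<^sub>0 'a. Poly_Mapping.lookup x i = 0}"
      by (rule fs.subspaceI) (simp_all add: lookup_add lookup_scale)
  qed (auto simp: lookup_basis_vec)
  then show False using i by (auto simp: lookup_basis_vec)
qed

lemma Hom_eq_on_V:
  assumes "g \<in> Hom \<kappa>" "h \<in> Hom \<kappa>'" "\<And>i. i < n \<Longrightarrow> g (basis_vec i) = h (basis_vec i)" "x \<in> V n"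
  shows "g x = h x"
proof (rule fsp.linear_eq_on_span[where B = "basis_vec ` {..<n}" and f = g and g = h])
  show "Vector_Spaces.linear scale scale g" "Vector_Spaces.linear scale scale h"
    using assms by (simp_all add: Hom_def)
  show "x \<in> fs.span (basis_vec ` {..<n})" using assms by (simp add: V_def)
  show "g b = h b" if "b \<in> basis_vec ` {..<n}" for b using that assms(3) by auto
qed

text \<open>\<open>construct\<close> takes values indexed by basis vectors, so
  \<open>inv basis_vec\<close> recovers the index. Haar measure will be transported along this map
  from sequences in \<open>V \<kappa>\<close> to \<open>Hom \<kappa>\<close>.\<close>

definition basis_extension :: "(nat \<Rightarrow> (nat \<Rightarrow>\<^sub>0 'a::field)) \<Rightarrow> (nat \<Rightarrow>\<^sub>0 'a) \<Rightarrow> (nat \<Rightarrow>\<^sub>0 'a)" where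
  "basis_extension v = fsp.construct (range basis_vec) (v \<circ> inv basis_vec)"

lemma basis_extension_basis_vec [simp]: "basis_extension v (basis_vec i) = v i"
  unfolding basis_extension_def
  by (subst fsp.construct_basis[OF independent_basis_vec]) (simp_all add: inv_f_f inj_basis_vec)

lemma basis_extension_in_Hom:
  fixes v :: "nat \<Rightarrow> (nat \<Rightarrow>\<^sub>0 'a::field)"
  assumes "\<And>i. v i \<in> V \<kappa>"
  shows "basis_extension v \<in> Hom \<kappa>"
proof -
  have "basis_extension v x \<in> V \<kappa>" for x
  proof -
    have "basis_extension v x \<in> fs.span ((v \<circ> inv basis_vec) ` range (basis_vec :: nat \<Rightarrow> (nat \<Rightarrow>\<^sub>0 'a)))"
      unfolding basis_extension_def by (rule fsp.construct_in_span[OF independent_basis_vec])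
    moreover have "fs.span ((v \<circ> inv basis_vec) ` range (basis_vec :: nat \<Rightarrow> (nat \<Rightarrow>\<^sub>0 'a))) \<subseteq> V \<kappa>"
      using assms by (intro fs.span_minimal subspace_V) auto
    ultimately show ?thesis by blast
  qed
  moreover have "Vector_Spaces.linear scale scale (basis_extension v)"
    unfolding basis_extension_def by (rule fsp.linear_construct[OF independent_basis_vec])
  ultimately show ?thesis by (simp add: Hom_def)
qed

lemma Hom_add:
  assumes "g \<in> Hom \<kappa>" "h \<in> Hom \<kappa>"
  shows "(\<lambda>x. g x + h x) \<in> Hom \<kappa>"
  using assms fs.subspace_add[OF subspace_V[of \<kappa>]]
  by (auto simp: Hom_def intro: fsp.linear_compose_add)

lemma Hom_uminus:
  assumes "g \<in> Hom \<kappa>"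
  shows "(\<lambda>x. - g x) \<in> Hom \<kappa>"
  using assms fs.subspace_neg[OF subspace_V[of \<kappa>]]
  by (auto simp: Hom_def intro: fsp.linear_compose_neg)

section \<open>Borel sets of a topology\<close>

lemma space_borel_of_topology [simp]: "space (borel_of_topology T) = topspace T"
  by (simp add: borel_of_topology_def space_measure_of_conv)

lemma sets_borel_of_topology:
  "sets (borel_of_topology T) = sigma_sets (topspace T) {U. openin T U}"
  unfolding borel_of_topology_def by (rule sets_measure_of) (auto dest: openin_subset)

lemma openin_borel_of_topology: "openin T U \<Longrightarrow> U \<in> sets (borel_of_topology T)"
  by (auto simp: sets_borel_of_topology)

lemma continuous_map_measurable:
  assumes "continuous_map X Y f"
  shows "f \<in> borel_of_topology X \<rightarrow>\<^sub>M borel_of_topology Y"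
  unfolding borel_of_topology_def[of Y]
proof (rule measurable_measure_of)
  show "{U. openin Y U} \<subseteq> Pow (topspace Y)" by (auto dest: openin_subset)
  show "f \<in> space (borel_of_topology X) \<rightarrow> topspace Y"
    using assms by (auto simp: continuous_map_def)
  fix U assume "U \<in> {U. openin Y U}"
  then have "openin X {x \<in> topspace X. f x \<in> U}"
    using assms by (simp add: continuous_map_def)
  moreover have "f -` U \<inter> space (borel_of_topology X) = {x \<in> topspace X. f x \<in> U}" by auto
  ultimately show "f -` U \<inter> space (borel_of_topology X) \<in> sets (borel_of_topology X)"
    by (simp add: openin_borel_of_topology)
qed

section \<open>Cylinder sets and the Borel sets of Hom\<close>

lemma topspace_Hom_topology [simp]: "topspace (Hom_topology \<kappa>) = Hom \<kappa>"
  by (auto simp: Hom_topology_def Hom_def topspace_product_topology)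

lemma continuous_map_Hom_eval:
  "continuous_map (Hom_topology \<kappa>) (discrete_topology (V \<kappa>)) (\<lambda>h. h x)"
  unfolding Hom_topology_def
  by (intro continuous_map_from_subtopology continuous_map_product_projection) simp

text \<open>For \<open>v\<close> = 0 this is the subgroup of maps vanishing on \<open>V n\<close>;
  the other nonempty cylinders of level n are its cosets. A \<open>v\<close> with one of its first n
  values outside \<open>V \<kappa>\<close> gives the empty set.\<close>

definition cyl :: "nat \<Rightarrow> nat \<Rightarrow> (nat \<Rightarrow> (nat \<Rightarrow>\<^sub>0 'a::field)) \<Rightarrow> ((nat \<Rightarrow>\<^sub>0 'a) \<Rightarrow> (nat \<Rightarrow>\<^sub>0 'a)) set" where
  "cyl \<kappa> n v = {h \<in> Hom \<kappa>. \<forall>i<n. h (basis_vec i) = v i}"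

lemma cyl_subset_Hom: "cyl \<kappa> n v \<subseteq> Hom \<kappa>"
  by (auto simp: cyl_def)

lemma cyl_0 [simp]: "cyl \<kappa> 0 v = Hom \<kappa>"
  by (simp add: cyl_def)

text \<open>Intersecting with \<open>V \<kappa>\<close> turns the new condition into the preimage of
  a subset of the discrete target, which gives openness by continuity of evaluation.\<close>

lemma cyl_Suc: "cyl \<kappa> (Suc n) v = cyl \<kappa> n v \<inter> {h \<in> topspace (Hom_topology \<kappa>). h (basis_vec n) \<in> {v n} \<inter> V \<kappa>}"
  by (auto simp: cyl_def less_Suc_eq Hom_def)

lemma openin_cyl: "openin (Hom_topology \<kappa>) (cyl \<kappa> n v)"
proof (induction n)
  case 0
  then show ?case by (simp flip: topspace_Hom_topology)
next
  case (Suc n)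
  have "openin (discrete_topology (V \<kappa>)) ({v n} \<inter> V \<kappa>)"
    unfolding openin_discrete_topology by blast
  note pre = openin_continuous_map_preimage[OF continuous_map_Hom_eval this]
  show ?case
    unfolding cyl_Suc by (rule openin_Int[OF Suc pre])
qed

text \<open>A basic product neighbourhood of h constrains only finitely many arguments. They all lie
  in some \<open>V n\<close>, where a homomorphism is determined by its values on the first n basis
  vectors.\<close>

lemma cyl_basis:
  assumes U: "openin (Hom_topology \<kappa>) U" and h: "h \<in> U"
  shows "\<exists>n. cyl \<kappa> n (h \<circ> basis_vec) \<subseteq> U"
proof -
  obtain T where T: "openin (product_topology (\<lambda>_. discrete_topology (V \<kappa>)) UNIV) T" "U = T \<inter> Hom \<kappa>"
    using U by (auto simp: Hom_topology_def openin_subtopology)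
  have hT: "h \<in> T" using h T by simp
  obtain W where W: "finite {x. W x \<noteq> V \<kappa>}" "h \<in> Pi\<^sub>E UNIV W" "Pi\<^sub>E UNIV W \<subseteq> T"
    using T(1)[unfolded openin_product_topology_alt] hT by auto
  obtain n where n: "{x. W x \<noteq> V \<kappa>} \<subseteq> V n" using finite_subset_V[OF W(1)] by blast
  have "cyl \<kappa> n (h \<circ> basis_vec) \<subseteq> U"
  proof
    fix g assume g: "g \<in> cyl \<kappa> n (h \<circ> basis_vec)"
    have "g x \<in> W x" for x
    proof (cases "W x = V \<kappa>")
      case True
      then show ?thesis using g by (simp add: cyl_def Hom_def)
    next
      case False
      then have "g x = h x"
        using g h n T(2) by (intro Hom_eq_on_V[of g \<kappa> h \<kappa> n x]) (simp_all add: cyl_def subset_iff)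
      then show ?thesis using W(2) by (auto simp: PiE_iff)
    qed
    then show "g \<in> U" using W(3) g T(2) by (auto simp: cyl_def)
  qed
  then show ?thesis ..
qed

text \<open>The empty set is added for stability under intersection; extensional tuples with entries
  in \<open>V \<kappa>\<close> keep the family countable over a finite field.\<close>

definition cyls :: "nat \<Rightarrow> ((nat \<Rightarrow>\<^sub>0 'a::field) \<Rightarrow> (nat \<Rightarrow>\<^sub>0 'a)) set set" where
  "cyls \<kappa> = insert {} (\<Union>n. cyl \<kappa> n ` ({..<n} \<rightarrow>\<^sub>E V \<kappa>))"

lemma cyls_iff: "A \<in> cyls \<kappa> \<longleftrightarrow> A = {} \<or> (\<exists>n. \<exists>v\<in>{..<n} \<rightarrow>\<^sub>E V \<kappa>. A = cyl \<kappa> n v)"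
  by (simp add: cyls_def image_iff)

lemma cyl_restrict: "cyl \<kappa> n (restrict v {..<n}) = cyl \<kappa> n v"
  by (auto simp: cyl_def)

lemma cyl_in_cyls:
  assumes "\<And>i. i < n \<Longrightarrow> v i \<in> V \<kappa>"
  shows "cyl \<kappa> n v \<in> cyls \<kappa>"
proof -
  have "restrict v {..<n} \<in> {..<n} \<rightarrow>\<^sub>E V \<kappa>"
    using assms by (simp add: restrict_PiE_iff)
  then show ?thesis unfolding cyls_iff using cyl_restrict by blast
qed

text \<open>Of two cylinders, the one of higher level is either contained in the other or disjoint
  from it, according to whether the prescribed values agree up to the lower level.\<close>

lemma Int_stable_cyls: "Int_stable (cyls \<kappa>)"
proof -
  have *: "cyl \<kappa> n v \<inter> cyl \<kappa> m u \<in> cyls \<kappa>" if "n \<le> m" "u \<in> {..<m} \<rightarrow>\<^sub>E V \<kappa>"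
    for n m and u v :: "nat \<Rightarrow> (nat \<Rightarrow>\<^sub>0 'a)"
  proof (cases "\<forall>i<n. v i = u i")
    case True
    then have "cyl \<kappa> n v \<inter> cyl \<kappa> m u = cyl \<kappa> m u" using that(1) by (auto simp: cyl_def)
    moreover have "cyl \<kappa> m u \<in> cyls \<kappa>" using that(2) by (intro cyl_in_cyls) auto
    ultimately show ?thesis by simp
  next
    case False
    then have "cyl \<kappa> n v \<inter> cyl \<kappa> m u = {}"
      using that(1) by (auto simp: cyl_def)
    then show ?thesis by (simp add: cyls_def)
  qed
  show ?thesis
  proof (rule Int_stableI)
    fix A B :: "((nat \<Rightarrow>\<^sub>0 'a) \<Rightarrow> (nat \<Rightarrow>\<^sub>0 'a)) set"
    assume A: "A \<in> cyls \<kappa>" and B: "B \<in> cyls \<kappa>"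
    show "A \<inter> B \<in> cyls \<kappa>"
    proof (cases "A = {} \<or> B = {}")
      case True
      then show ?thesis by (auto simp: cyls_def)
    next
      case False
      then obtain n v m u where "A = cyl \<kappa> n v" "v \<in> {..<n} \<rightarrow>\<^sub>E V \<kappa>" "B = cyl \<kappa> m u" "u \<in> {..<m} \<rightarrow>\<^sub>E V \<kappa>"
        using A B unfolding cyls_iff by blast
      then show ?thesis using *[of n m u v] *[of m n v u] by (cases "n \<le> m") (simp_all add: Int_commute)
    qed
  qed
qed

lemma countable_cyls: "countable (cyls \<kappa> :: ((nat \<Rightarrow>\<^sub>0 'a::{field,finite}) \<Rightarrow> (nat \<Rightarrow>\<^sub>0 'a)) set set)"
  unfolding cyls_def
  by (intro countable_insert countable_UN countable_image) (auto intro!: countable_finite finite_PiE)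

text \<open>Cylinders are open, and every open set is the union of the cylinders inside it; as there
  are only countably many cylinders, this union stays in the generated sigma-algebra.\<close>

lemma sets_borel_Hom:
  "sets (borel_of_topology (Hom_topology \<kappa>)) =
    sigma_sets (Hom \<kappa>) (cyls \<kappa> :: ((nat \<Rightarrow>\<^sub>0 'a::{field,finite}) \<Rightarrow> (nat \<Rightarrow>\<^sub>0 'a)) set set)"
proof -
  let ?C = "cyls \<kappa> :: ((nat \<Rightarrow>\<^sub>0 'a) \<Rightarrow> (nat \<Rightarrow>\<^sub>0 'a)) set set"
  have C: "?C \<subseteq> Pow (Hom \<kappa>)" using cyl_subset_Hom by (auto simp: cyls_def)
  interpret S: sigma_algebra "Hom \<kappa>" "sigma_sets (Hom \<kappa>) ?C"
    using C by (rule sigma_algebra_sigma_sets)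
  show ?thesis
    unfolding sets_borel_of_topology topspace_Hom_topology
  proof (rule sigma_sets_eqI)
    fix U assume "U \<in> {U. openin (Hom_topology \<kappa> :: ((nat \<Rightarrow>\<^sub>0 'a) \<Rightarrow> (nat \<Rightarrow>\<^sub>0 'a)) topology) U}"
    then have U: "openin (Hom_topology \<kappa>) U" by simp
    have "U = \<Union>{c \<in> ?C. c \<subseteq> U}"
    proof (intro equalityI subsetI)
      fix h assume h: "h \<in> U"
      then have hom: "h \<in> Hom \<kappa>" using openin_subset[OF U] by auto
      obtain n where n: "cyl \<kappa> n (h \<circ> basis_vec) \<subseteq> U" using cyl_basis[OF U h] ..
      have "cyl \<kappa> n (h \<circ> basis_vec) \<in> ?C"
        using hom by (intro cyl_in_cyls) (simp add: Hom_def)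
      moreover have "h \<in> cyl \<kappa> n (h \<circ> basis_vec)" using hom by (simp add: cyl_def)
      ultimately show "h \<in> \<Union>{c \<in> ?C. c \<subseteq> U}" using n by blast
    qed auto
    also have "\<dots> \<in> sigma_sets (Hom \<kappa>) ?C"
      by (intro sigma_sets_UNION countable_subset[OF _ countable_cyls]) auto
    finally show "U \<in> sigma_sets (Hom \<kappa>) ?C" .
  next
    fix c assume "c \<in> ?C"
    then have "c = {} \<or> (\<exists>n v. c = cyl \<kappa> n v)" unfolding cyls_iff by blast
    then consider "c = {}" | n v where "c = cyl \<kappa> n v" by metis
    then have "openin (Hom_topology \<kappa>) c"
      by cases (simp_all only: openin_cyl openin_empty)
    then show "c \<in> sigma_sets (Hom \<kappa>) {U. openin (Hom_topology \<kappa>) U}"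
      by (rule sigma_sets.Basic[OF CollectI])
  qed
qed


section \<open>Normalized Haar measure\<close>

lemma measure_cyl_translate:
  assumes M: "is_normalized_Haar \<kappa> M" and v: "\<And>i. i < n \<Longrightarrow> v i \<in> V \<kappa>"
  shows "measure M (cyl \<kappa> n v) = measure M (cyl \<kappa> n (\<lambda>_. 0))"
proof -
  \<comment> \<open>Only the first n values of \<open>v\<close> are known to lie in
    \<open>V \<kappa>\<close>; continuing by 0 keeps \<open>g\<close> in
    \<open>Hom \<kappa>\<close>. Translation by \<open>g\<close> then carries the zero cylinder onto
    \<open>cyl \<kappa> n v\<close>.\<close>
  define g where "g = basis_extension (\<lambda>i. if i < n then v i else 0)"
  have g: "g \<in> Hom \<kappa>"
    unfolding g_def using v by (intro basis_extension_in_Hom) simp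
  have gv: "g (basis_vec i) = v i" if "i < n" for i
    using that by (simp add: g_def)
  have "cyl \<kappa> n v = (\<lambda>h x. g x + h x) ` cyl \<kappa> n (\<lambda>_. 0)"
  proof (intro equalityI subsetI)
    fix h assume h: "h \<in> cyl \<kappa> n v"
    have "(\<lambda>x. - g x + h x) \<in> Hom \<kappa>"
      using h by (intro Hom_add Hom_uminus g) (simp add: cyl_def)
    then have "(\<lambda>x. - g x + h x) \<in> cyl \<kappa> n (\<lambda>_. 0)"
      using h gv by (simp add: cyl_def)
    then show "h \<in> (\<lambda>h x. g x + h x) ` cyl \<kappa> n (\<lambda>_. 0)"
      by (rule rev_image_eqI) simp
  next
    fix h assume "h \<in> (\<lambda>h x. g x + h x) ` cyl \<kappa> n (\<lambda>_. 0)"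
    then obtain f where "f \<in> cyl \<kappa> n (\<lambda>_. 0)" "h = (\<lambda>x. g x + f x)" by blast
    then show "h \<in> cyl \<kappa> n v"
      using gv by (simp add: cyl_def Hom_add[OF g])
  qed
  moreover have "cyl \<kappa> n (\<lambda>_. 0) \<in> sets M"
    using M openin_borel_of_topology[OF openin_cyl] by (simp add: is_normalized_Haar_def)
  ultimately show ?thesis
    using M g by (simp add: is_normalized_Haar_def measure_def)
qed

text \<open>The nonempty cylinders of level n partition \<open>Hom \<kappa>\<close> into q^(\<kappa>
  n) sets of equal mass. Singletons \<open>G\<close> yield uniqueness of Haar measure; the tuples of
  fixed rank yield the probability in the theorem.\<close>

lemma measure_UN_cyl:
  fixes M :: "((nat \<Rightarrow>\<^sub>0 'a::{field,finite}) \<Rightarrow> (nat \<Rightarrow>\<^sub>0 'a)) measure"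
  assumes M: "is_normalized_Haar \<kappa> M" and G: "G \<subseteq> {..<n} \<rightarrow>\<^sub>E V \<kappa>"
  shows "measure M (\<Union>v\<in>G. cyl \<kappa> n v) = real (card G) / (real CARD('a) ^ \<kappa>) ^ n"
proof -
  interpret prob_space M using M by (simp add: is_normalized_Haar_def)
  let ?P = "{..<n} \<rightarrow>\<^sub>E (V \<kappa> :: (nat \<Rightarrow>\<^sub>0 'a) set)"
  have finP: "finite ?P" by (simp add: finite_PiE)
  have sets: "cyl \<kappa> n v \<in> sets M" for v
    using M openin_borel_of_topology[OF openin_cyl] by (simp add: is_normalized_Haar_def)
  have disj: "disjoint_family_on (cyl \<kappa> n) ?P"
    unfolding disjoint_family_on_def
  proof (intro ballI impI)
    fix u v assume uv: "u \<in> ?P" "v \<in> ?P" "u \<noteq> v"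
    then obtain i where "i < n" "u i \<noteq> v i"
      using PiE_ext[of u "{..<n}" "\<lambda>_. V \<kappa>" v] by auto
    then show "cyl \<kappa> n u \<inter> cyl \<kappa> n v = {}" by (auto simp: cyl_def)
  qed
  \<comment> \<open>Used with all tuples, where total mass 1 determines the common mass of a
    cylinder, and then with \<open>G\<close>.\<close>
  have sum: "measure M (\<Union>v\<in>H. cyl \<kappa> n v) = card H * measure M (cyl \<kappa> n (\<lambda>_. 0))"
    if H: "H \<subseteq> ?P" for H
  proof -
    have "measure M (\<Union>v\<in>H. cyl \<kappa> n v) = (\<Sum>v\<in>H. measure M (cyl \<kappa> n v))"
    proof (rule finite_measure_finite_Union)
      show "finite H" using H finP finite_subset by blast
      show "cyl \<kappa> n ` H \<subseteq> sets M" using sets by blast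
      show "disjoint_family_on (cyl \<kappa> n) H" using disj H disjoint_family_on_mono by blast
    qed
    also have "\<dots> = (\<Sum>v\<in>H. measure M (cyl \<kappa> n (\<lambda>_. 0)))"
      using H by (intro sum.cong refl measure_cyl_translate[OF M]) (auto dest!: subsetD intro: PiE_mem)
    finally show ?thesis by simp
  qed
  have "(\<Union>v\<in>?P. cyl \<kappa> n v) = Hom \<kappa>"
  proof (intro equalityI subsetI)
    fix h :: "(nat \<Rightarrow>\<^sub>0 'a) \<Rightarrow> (nat \<Rightarrow>\<^sub>0 'a)" assume h: "h \<in> Hom \<kappa>"
    then have "restrict (h \<circ> basis_vec) {..<n} \<in> ?P"
      by (simp add: restrict_PiE_iff Hom_def)
    moreover have "h \<in> cyl \<kappa> n (restrict (h \<circ> basis_vec) {..<n})"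
      using h by (simp add: cyl_def)
    ultimately show "h \<in> (\<Union>v\<in>?P. cyl \<kappa> n v)" by blast
  qed (use cyl_subset_Hom in blast)
  moreover have "Hom \<kappa> = space M"
    using M sets_eq_imp_space_eq[of M "borel_of_topology (Hom_topology \<kappa>)"]
    by (simp add: is_normalized_Haar_def)
  moreover have "card ?P = (CARD('a) ^ \<kappa>) ^ n"
    by (simp add: card_PiE card_V)
  ultimately have "(real CARD('a) ^ \<kappa>) ^ n * measure M (cyl \<kappa> n (\<lambda>_. 0)) = 1"
    using sum[OF order_refl] prob_space by simp
  then show ?thesis
    using sum[OF G] by (simp add: field_simps)
qed

text \<open>Cylinders form an intersection-stable generator. The criterion serves twice: for
  uniqueness, and for comparing a measure with its translate.\<close>

lemma measure_eq_on_cyls: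
  fixes M N :: "((nat \<Rightarrow>\<^sub>0 'a::{field,finite}) \<Rightarrow> (nat \<Rightarrow>\<^sub>0 'a)) measure"
  assumes "sets M = sets (borel_of_topology (Hom_topology \<kappa>))"
    and "sets N = sets (borel_of_topology (Hom_topology \<kappa>))"
    and fin: "emeasure M (Hom \<kappa>) \<noteq> \<infinity>"
    and eq: "\<And>n v. v \<in> {..<n} \<rightarrow>\<^sub>E V \<kappa> \<Longrightarrow> emeasure M (cyl \<kappa> n v) = emeasure N (cyl \<kappa> n v)"
  shows "M = N"
proof (rule measure_eqI_generator_eq[OF Int_stable_cyls])
  show "cyls \<kappa> \<subseteq> Pow (Hom \<kappa> :: ((nat \<Rightarrow>\<^sub>0 'a) \<Rightarrow> (nat \<Rightarrow>\<^sub>0 'a)) set)"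
    using cyl_subset_Hom by (auto simp: cyls_def)
  show "sets M = sigma_sets (Hom \<kappa>) (cyls \<kappa>)" "sets N = sigma_sets (Hom \<kappa>) (cyls \<kappa>)"
    by (simp_all add: assms sets_borel_Hom)
  show "emeasure M X = emeasure N X" if "X \<in> cyls \<kappa>" for X
    using that eq unfolding cyls_iff by auto
  \<comment> \<open>The whole space is the cylinder of level 0, so a constant sequence of generators
    exhausts it.\<close>
  have "cyl \<kappa> 0 (\<lambda>_. 0) \<in> (cyls \<kappa> :: ((nat \<Rightarrow>\<^sub>0 'a) \<Rightarrow> (nat \<Rightarrow>\<^sub>0 'a)) set set)"
    by (rule cyl_in_cyls) simp
  then show "range (\<lambda>_::nat. Hom \<kappa>) \<subseteq> (cyls \<kappa> :: ((nat \<Rightarrow>\<^sub>0 'a) \<Rightarrow> (nat \<Rightarrow>\<^sub>0 'a)) set set)"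
    by simp
qed (use fin in simp_all)

lemma normalized_Haar_unique:
  fixes M N :: "((nat \<Rightarrow>\<^sub>0 'a::{field,finite}) \<Rightarrow> (nat \<Rightarrow>\<^sub>0 'a)) measure"
  assumes M: "is_normalized_Haar \<kappa> M" and N: "is_normalized_Haar \<kappa> N"
  shows "M = N"
proof (rule measure_eq_on_cyls)
  show sets: "sets M = sets (borel_of_topology (Hom_topology \<kappa>))"
    "sets N = sets (borel_of_topology (Hom_topology \<kappa>))"
    using M N by (simp_all add: is_normalized_Haar_def)
  interpret M: prob_space M using M by (simp add: is_normalized_Haar_def)
  interpret N: prob_space N using N by (simp add: is_normalized_Haar_def)
  show "emeasure M (Hom \<kappa>) \<noteq> \<infinity>" by simp
  show "emeasure M (cyl \<kappa> n v) = emeasure N (cyl \<kappa> n v)" if "v \<in> {..<n} \<rightarrow>\<^sub>E V \<kappa>" for n v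
    using measure_UN_cyl[OF M, of "{v}" n] measure_UN_cyl[OF N, of "{v}" n] that
    by (simp add: M.emeasure_eq_measure N.emeasure_eq_measure)
qed

section \<open>Existence of normalized Haar measure\<close>

lemma continuous_map_into_Hom:
  assumes "\<And>x. continuous_map X (discrete_topology (V \<kappa>)) (\<lambda>h. f h x)"
    and "f \<in> topspace X \<rightarrow> Hom \<kappa>"
  shows "continuous_map X (Hom_topology \<kappa>) f"
  unfolding Hom_topology_def continuous_map_in_subtopology continuous_map_componentwise_UNIV
  using assms by blast

lemma continuous_map_Hom_add:
  assumes g: "g \<in> Hom \<kappa>"
  shows "continuous_map (Hom_topology \<kappa>) (Hom_topology \<kappa>) (\<lambda>h x. g x + h x)"
proof (rule continuous_map_into_Hom)
  fix x
  have "continuous_map (discrete_topology (V \<kappa>)) (discrete_topology (V \<kappa>)) (\<lambda>y. g x + y)"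
    using g fs.subspace_add[OF subspace_V[of \<kappa>]] by (auto simp: Hom_def)
  from continuous_map_compose[OF continuous_map_Hom_eval this]
  show "continuous_map (Hom_topology \<kappa>) (discrete_topology (V \<kappa>)) (\<lambda>h. g x + h x)"
    by (simp add: o_def)
qed (use Hom_add[OF g] in auto)

text \<open>The measure is the image under \<open>basis_extension\<close> of the infinite product of
  uniform measures on \<open>V \<kappa>\<close>, that is, the values on the basis are independent
  and uniform.\<close>

lemma ex_normalized_Haar:
  "\<exists>M :: ((nat \<Rightarrow>\<^sub>0 'a::{field,finite}) \<Rightarrow> (nat \<Rightarrow>\<^sub>0 'a)) measure. is_normalized_Haar \<kappa> M"
proof -
  let ?W = "V \<kappa> :: (nat \<Rightarrow>\<^sub>0 'a) set"
  let ?B = "borel_of_topology (Hom_topology \<kappa>) :: ((nat \<Rightarrow>\<^sub>0 'a) \<Rightarrow> (nat \<Rightarrow>\<^sub>0 'a)) measure"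
  let ?Q = "CARD('a) ^ \<kappa>"
  have W: "?W \<noteq> {}" using zero_in_V[of \<kappa>] by blast
  interpret U: prob_space "uniform_count_measure ?W"
    by (rule prob_space_uniform_count_measure) (simp_all add: W)
  interpret P: product_prob_space "\<lambda>_::nat. uniform_count_measure ?W" UNIV ..
  define P where "P = PiM UNIV (\<lambda>_::nat. uniform_count_measure ?W)"
  have space_P: "space P = UNIV \<rightarrow>\<^sub>E ?W"
    by (simp add: P_def space_PiM space_uniform_count_measure)
  \<comment> \<open>The preimage of a cylinder fixes the first n coordinates of the sequence, so its
    product measure is a finite product of point masses 1/q^\<kappa>.\<close>
  have emb: "basis_extension -` cyl \<kappa> n v \<inter> space P =
      prod_emb UNIV (\<lambda>_. uniform_count_measure ?W) {..<n} (Pi\<^sub>E {..<n} (\<lambda>i. {v i}))" for n v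
  proof (rule set_eqI)
    fix u :: "nat \<Rightarrow> (nat \<Rightarrow>\<^sub>0 'a)"
    show "u \<in> basis_extension -` cyl \<kappa> n v \<inter> space P \<longleftrightarrow>
      u \<in> prod_emb UNIV (\<lambda>_. uniform_count_measure ?W) {..<n} (Pi\<^sub>E {..<n} (\<lambda>i. {v i}))"
      unfolding prod_emb_def space_P using basis_extension_in_Hom[of u \<kappa>]
      by (simp add: cyl_def space_uniform_count_measure restrict_PiE_iff PiE_iff)
        (auto simp: extensional_def)
  qed
  have emb_sets: "basis_extension -` cyl \<kappa> n v \<inter> space P \<in> sets P" if "v \<in> {..<n} \<rightarrow>\<^sub>E ?W" for n v
    unfolding emb unfolding P_def using that
    by (intro sets_PiM_I) (auto simp: sets_uniform_count_measure)
  have emb_P: "emeasure P (basis_extension -` cyl \<kappa> n v \<inter> space P) = ennreal (1 / ?Q) ^ n"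
    if v: "v \<in> {..<n} \<rightarrow>\<^sub>E ?W" for n v
  proof -
    have "emeasure P (basis_extension -` cyl \<kappa> n v \<inter> space P)
        = (\<Prod>i<n. emeasure (uniform_count_measure ?W) {v i})"
      unfolding emb unfolding P_def using v
      by (intro P.emeasure_PiM_emb) (auto simp: sets_uniform_count_measure)
    also have "\<dots> = (\<Prod>i<n. ennreal (1 / ?Q))"
    proof (rule prod.cong[OF refl])
      fix i assume "i \<in> {..<n}"
      with v have "v i \<in> ?W" by (rule PiE_mem)
      then show "emeasure (uniform_count_measure ?W) {v i} = ennreal (1 / ?Q)"
        by (simp add: emeasure_uniform_count_measure card_V)
    qed
    finally show ?thesis by simp
  qed
  have meas: "basis_extension \<in> P \<rightarrow>\<^sub>M ?B"
  proof (rule measurable_sigma_sets[OF sets_borel_Hom])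
    show "cyls \<kappa> \<subseteq> Pow (Hom \<kappa> :: ((nat \<Rightarrow>\<^sub>0 'a) \<Rightarrow> (nat \<Rightarrow>\<^sub>0 'a)) set)"
      using cyl_subset_Hom by (auto simp: cyls_def)
    show "basis_extension \<in> space P \<rightarrow> Hom \<kappa>"
      using basis_extension_in_Hom by (auto simp: space_P PiE_iff)
    show "basis_extension -` y \<inter> space P \<in> sets P" if "y \<in> cyls \<kappa>" for y
      using that emb_sets unfolding cyls_iff by auto
  qed
  define M where "M = distr P ?B basis_extension"
  have sets_M: "sets M = sets ?B" by (simp add: M_def)
  have M_cyl: "emeasure M (cyl \<kappa> n v) = ennreal (1 / ?Q) ^ n" if "\<And>i. i < n \<Longrightarrow> v i \<in> V \<kappa>" for n v
  proof -
    have "restrict v {..<n} \<in> {..<n} \<rightarrow>\<^sub>E ?W" using that by (simp add: restrict_PiE_iff)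
    from emb_P[OF this] show ?thesis
      unfolding M_def cyl_restrict
      by (simp add: emeasure_distr[OF meas] openin_borel_of_topology openin_cyl)
  qed
  have prob: "prob_space M"
    unfolding M_def by (rule prob_space.prob_space_distr[OF _ meas]) (simp add: P_def P.prob_space_axioms)
  have "is_normalized_Haar \<kappa> M"
    unfolding is_normalized_Haar_def
  proof (intro conjI ballI prob sets_M)
    fix g :: "(nat \<Rightarrow>\<^sub>0 'a) \<Rightarrow> (nat \<Rightarrow>\<^sub>0 'a)" and A
    assume g: "g \<in> Hom \<kappa>" and A: "A \<in> sets M"
    \<comment> \<open>Translation by -g is used because its preimages are the images under
      translation by g that occur in the definition of invariance.\<close>
    let ?t = "\<lambda>h x. - g x + h x"
    have t: "?t \<in> M \<rightarrow>\<^sub>M ?B"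
      unfolding measurable_cong_sets[OF sets_M refl]
      by (intro continuous_map_measurable continuous_map_Hom_add Hom_uminus g)
    \<comment> \<open>The preimage of a level n cylinder under \<open>?t\<close> is again a level n
      cylinder with values in \<open>V \<kappa>\<close>, and all of these have the same
      mass.\<close>
    have "M = distr M ?B ?t"
    proof (rule measure_eq_on_cyls)
      show "sets M = sets ?B" "sets (distr M ?B ?t) = sets ?B" by (simp_all add: sets_M)
      show "emeasure M (Hom \<kappa>) \<noteq> \<infinity>"
        using finite_measure.emeasure_finite[OF prob_space.finite_measure[OF prob]] by simp
      fix n :: nat and v assume v: "v \<in> {..<n} \<rightarrow>\<^sub>E ?W"
      have "?t -` cyl \<kappa> n v \<inter> space M = cyl \<kappa> n (\<lambda>i. g (basis_vec i) + v i)"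
      proof (rule set_eqI)
        fix h :: "(nat \<Rightarrow>\<^sub>0 'a) \<Rightarrow> (nat \<Rightarrow>\<^sub>0 'a)"
        have "- a + b = c \<longleftrightarrow> b = a + c" for a b c :: "nat \<Rightarrow>\<^sub>0 'a"
          by (auto simp: algebra_simps)
        then show "h \<in> ?t -` cyl \<kappa> n v \<inter> space M \<longleftrightarrow> h \<in> cyl \<kappa> n (\<lambda>i. g (basis_vec i) + v i)"
          using Hom_add[OF Hom_uminus[OF g], of h] by (auto simp: cyl_def M_def)
      qed
      moreover have "g (basis_vec i) + v i \<in> V \<kappa>" if "i < n" for i
        using that v g by (intro fs.subspace_add subspace_V) (auto simp: Hom_def PiE_mem)
      moreover have "emeasure (distr M ?B ?t) (cyl \<kappa> n v) = emeasure M (?t -` cyl \<kappa> n v \<inter> space M)"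
        by (rule emeasure_distr[OF t openin_borel_of_topology[OF openin_cyl]])
      moreover have "v i \<in> V \<kappa>" if "i < n" for i
        using PiE_mem[OF v, of i] that by simp
      ultimately show "emeasure M (cyl \<kappa> n v) = emeasure (distr M ?B ?t) (cyl \<kappa> n v)"
        by (simp only: M_cyl)
    qed
    then have "emeasure M A = emeasure (distr M ?B ?t) A" by simp
    also have "\<dots> = emeasure M (?t -` A \<inter> space M)"
      using A unfolding sets_M by (rule emeasure_distr[OF t])
    also have "?t -` A \<inter> space M = (\<lambda>h x. g x + h x) ` A"
    proof (intro equalityI subsetI)
      fix h assume "h \<in> ?t -` A \<inter> space M"
      then have "?t h \<in> A" by simp
      then show "h \<in> (\<lambda>h x. g x + h x) ` A" by (rule rev_image_eqI) simp
    next
      fix h assume "h \<in> (\<lambda>h x. g x + h x) ` A"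
      then obtain f where f: "f \<in> A" and h: "h = (\<lambda>x. g x + f x)" by blast
      have "f \<in> Hom \<kappa>" using sets.sets_into_space[OF A] f by (auto simp: M_def)
      then show "h \<in> ?t -` A \<inter> space M" using f Hom_add[OF g] by (simp add: h M_def)
    qed
    finally show "emeasure M ((\<lambda>h x. g x + h x) ` A) = emeasure M A" ..
  qed
  then show ?thesis ..
qed

lemma Haar_is_normalized_Haar: "is_normalized_Haar \<kappa> (Haar \<kappa>)"
  unfolding Haar_def by (rule theI') (use ex_normalized_Haar normalized_Haar_unique in blast)

section \<open>The law of the kernel\<close>

lemma subspace_Ker: "h \<in> Hom \<kappa> \<Longrightarrow> fs.subspace (Ker h)"
  unfolding Ker_def Hom_def by (blast intro: fsp.linear_subspace_kernel)

lemma topspace_Sub_topology [simp]: "topspace Sub_topology = {X. fs.subspace X}"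
  by (auto simp: Sub_topology_def topspace_pullback_topology)

text \<open>Whether x lies in the kernel depends on \<open>h x\<close> alone, and evaluation at x is
  continuous into a discrete space. This makes \<open>Ker\<close> measurable.\<close>

lemma continuous_map_Ker:
  "continuous_map (Hom_topology \<kappa>) Sub_topology
    (Ker :: ((nat \<Rightarrow>\<^sub>0 'a::field) \<Rightarrow> (nat \<Rightarrow>\<^sub>0 'a)) \<Rightarrow> _)"
  unfolding Sub_topology_def
proof (rule continuous_map_pullback')
  show "topspace (Hom_topology \<kappa>) \<subseteq> Ker -` {X. fs.subspace X}"
    using subspace_Ker by auto
  show "continuous_map (Hom_topology \<kappa>) (product_topology (\<lambda>_. discrete_topology (UNIV :: bool set)) UNIV)
      ((\<lambda>X x. x \<in> X) \<circ> (Ker :: ((nat \<Rightarrow>\<^sub>0 'a) \<Rightarrow> (nat \<Rightarrow>\<^sub>0 'a)) \<Rightarrow> _))"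
    unfolding continuous_map_componentwise_UNIV
  proof
    fix x :: "nat \<Rightarrow>\<^sub>0 'a"
    have "continuous_map (discrete_topology (V \<kappa>)) (discrete_topology (UNIV :: bool set)) (\<lambda>y. y = (0 :: nat \<Rightarrow>\<^sub>0 'a))"
      by simp
    from continuous_map_compose[OF continuous_map_Hom_eval[of \<kappa> x] this]
    show "continuous_map (Hom_topology \<kappa>) (discrete_topology (UNIV :: bool set)) (\<lambda>h. ((\<lambda>X x. x \<in> X) \<circ> Ker) h x)"
      by (simp add: o_def Ker_def)
  qed
qed

text \<open>Over a finite field \<open>V n\<close> is finite, so X \<inter> V n is fixed by finitely
  many membership conditions and every quantity depending only on it is locally constant. In
  particular the event of the theorem is a Borel set.\<close>

lemma openin_dim_Int_V:
  "openin Sub_topology {X :: (nat \<Rightarrow>\<^sub>0 'a::{field,finite}) set. fs.subspace X \<and> fs.dim (X \<inter> V n) = k}"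
proof (subst openin_subopen, clarify)
  fix X :: "(nat \<Rightarrow>\<^sub>0 'a) set" assume X: "fs.subspace X" and k: "k = fs.dim (X \<inter> V n)"
  \<comment> \<open>Membership is prescribed as in \<open>X\<close> on \<open>V n\<close> and left
    free elsewhere.\<close>
  let ?W = "Pi\<^sub>E UNIV (\<lambda>x. if x \<in> V n then {x \<in> X} else UNIV)"
  let ?T = "(\<lambda>Y x. x \<in> Y) -` ?W \<inter> {Y. fs.subspace Y}"
  have "openin (product_topology (\<lambda>_. discrete_topology (UNIV :: bool set)) UNIV) ?W"
    unfolding openin_PiE_gen
    by (intro disjI2 conjI) (auto intro: finite_subset[OF _ finite_V[of n]])
  then have "openin Sub_topology ?T"
    unfolding Sub_topology_def openin_pullback_topology by blast
  moreover have "X \<in> ?T"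
    using X by (simp add: PiE_iff)
  moreover have "?T \<subseteq> {Y. fs.subspace Y \<and> fs.dim (Y \<inter> V n) = fs.dim (X \<inter> V n)}"
  proof
    fix Y assume "Y \<in> ?T"
    then have Y: "(\<lambda>x. x \<in> Y) \<in> ?W" and sub: "fs.subspace Y" by simp_all
    have "x \<in> Y \<longleftrightarrow> x \<in> X" if "x \<in> V n" for x
      using PiE_mem[OF Y UNIV_I, of x] that by simp
    then have "Y \<inter> V n = X \<inter> V n" by blast
    with sub show "Y \<in> {Y. fs.subspace Y \<and> fs.dim (Y \<inter> V n) = fs.dim (X \<inter> V n)}" by simp
  qed
  ultimately show "\<exists>T. openin Sub_topology T \<and> X \<in> T \<and>
      T \<subseteq> {Y. fs.subspace Y \<and> fs.dim (Y \<inter> V n) = fs.dim (X \<inter> V n)}"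
    by (intro exI[of _ ?T] conjI)
qed

text \<open>Rank-nullity for the restriction of h to \<open>V n\<close>, whose image is spanned by
  the values on the first n basis vectors.\<close>

lemma card_Ker_Int_V:
  fixes h :: "(nat \<Rightarrow>\<^sub>0 'a::{field,finite}) \<Rightarrow> (nat \<Rightarrow>\<^sub>0 'a)"
  assumes "h \<in> Hom \<kappa>"
  shows "card (Ker h \<inter> V n) * card (fs.span ((h \<circ> basis_vec) ` {..<n})) = CARD('a) ^ n"
proof -
  interpret h: Vector_Spaces.linear "scale :: 'a \<Rightarrow> _" scale h using assms by (simp add: Hom_def)
  have "Ker h \<inter> V n = {x \<in> V n. h x = 0}" by (auto simp: Ker_def)
  moreover have "fs.span ((h \<circ> basis_vec) ` {..<n}) = h ` V n"
    unfolding image_comp[symmetric] V_def by (rule h.span_image)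
  ultimately show ?thesis
    using h.card_kernel_mult_card_image[OF subspace_V[of n]] by (simp add: card_V)
qed

theorem corollary5p15:
  fixes q n k \<kappa> :: nat
  assumes "q = CARD('a::{field,finite})"
    and "k \<le> n"
    and "n - k \<le> \<kappa>"
  shows "measure (\<mu> \<kappa>)
      {X :: (nat \<Rightarrow>\<^sub>0 'a) set. module.subspace scale X \<and> vector_space.dim scale (X \<inter> V n) = k}
    = real q powr ((real n - real k) * (real n - real k - 1) / 2 - real \<kappa> * real n)
      * (s q \<kappa> * s q n / (s q (n - k) * s q (\<kappa> - (n - k)) * s q k))"
proof -
  define r where "r = n - k"
  have nk: "n = k + r" using assms(2) by (simp add: r_def)
  have "card {0, 1 :: 'a} \<le> CARD('a)" by (rule card_mono) simp_all
  then have q: "q > 1" by (simp add: assms(1))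
  have nz: "s q j \<noteq> 0" for j using s_pos[OF q, of j] by simp
  let ?E = "{X :: (nat \<Rightarrow>\<^sub>0 'a) set. fs.subspace X \<and> fs.dim (X \<inter> V n) = k}"
  let ?T = "tuples_of_rank scale (V \<kappa> :: (nat \<Rightarrow>\<^sub>0 'a) set) n r"
  have sets: "sets (Haar \<kappa> :: ((nat \<Rightarrow>\<^sub>0 'a) \<Rightarrow> _) measure) = sets (borel_of_topology (Hom_topology \<kappa>))"
    by (simp add: Haar_is_normalized_Haar[unfolded is_normalized_Haar_def])
  have Ker: "Ker \<in> (Haar \<kappa> :: ((nat \<Rightarrow>\<^sub>0 'a) \<Rightarrow> _) measure) \<rightarrow>\<^sub>M borel_of_topology Sub_topology"
    unfolding measurable_cong_sets[OF sets refl]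
    by (rule continuous_map_measurable[OF continuous_map_Ker])
  \<comment> \<open>With d the dimension of the kernel part, rank-nullity reads q^d * |span| = q^k *
    q^r; cancelling one factor gives the other, and exponents can be compared because q > 1.\<close>
  have dim: "fs.dim (Ker h \<inter> V n) = k \<longleftrightarrow> card (fs.span ((h \<circ> basis_vec) ` {..<n})) = q ^ r"
    if h: "h \<in> Hom \<kappa>" for h :: "(nat \<Rightarrow>\<^sub>0 'a) \<Rightarrow> (nat \<Rightarrow>\<^sub>0 'a)"
  proof -
    let ?d = "fs.dim (Ker h \<inter> V n)" and ?c = "card (fs.span ((h \<circ> basis_vec) ` {..<n}))"
    have "card (Ker h \<inter> V n) = q ^ ?d"
      unfolding assms(1)
      by (intro fs.card_subspace fs.subspace_inter subspace_V subspace_Ker[OF h]) simp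
    then have prod: "q ^ ?d * ?c = q ^ k * q ^ r"
      using card_Ker_Int_V[OF h, of n] by (simp add: assms(1) nk power_add)
    show ?thesis
    proof
      assume "?d = k"
      with prod show "?c = q ^ r" using q by simp
    next
      assume "?c = q ^ r"
      with prod have "q ^ ?d = q ^ k" using q by simp
      then show "?d = k" using q by (simp add: power_inject_exp)
    qed
  qed
  \<comment> \<open>The event depends only on the first n basis values, hence is a union of level n
    cylinders, one for each tuple of rank r.\<close>
  have vimage: "Ker -` ?E \<inter> space (Haar \<kappa>) = (\<Union>v\<in>?T. cyl \<kappa> n v)"
  proof (intro equalityI subsetI)
    fix h assume "h \<in> Ker -` ?E \<inter> space (Haar \<kappa> :: ((nat \<Rightarrow>\<^sub>0 'a) \<Rightarrow> _) measure)"
    then have h: "h \<in> Hom \<kappa>" and k: "fs.dim (Ker h \<inter> V n) = k"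
      using sets_eq_imp_space_eq[OF sets] by simp_all
    have im: "restrict (h \<circ> basis_vec) {..<n} ` {..<n} = (h \<circ> basis_vec) ` {..<n}"
      by (rule image_cong) simp_all
    have "restrict (h \<circ> basis_vec) {..<n} \<in> ?T"
      unfolding tuples_of_rank_def mem_Collect_eq im
      using dim[OF h] k h by (simp add: assms(1) restrict_PiE_iff Hom_def)
    moreover have "h \<in> cyl \<kappa> n (restrict (h \<circ> basis_vec) {..<n})"
      using h by (simp add: cyl_def)
    ultimately show "h \<in> (\<Union>v\<in>?T. cyl \<kappa> n v)" by blast
  next
    fix h assume "h \<in> (\<Union>v\<in>?T. cyl \<kappa> n v)"
    then obtain v where v: "v \<in> ?T" and hv: "h \<in> cyl \<kappa> n v" by blast
    have h: "h \<in> Hom \<kappa>" using hv by (simp add: cyl_def)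
    have "(h \<circ> basis_vec) ` {..<n} = v ` {..<n}"
      using hv by (intro image_cong) (simp_all add: cyl_def)
    then have "fs.dim (Ker h \<inter> V n) = k"
      using dim[OF h] v by (simp add: tuples_of_rank_def assms(1))
    then show "h \<in> Ker -` ?E \<inter> space (Haar \<kappa>)"
      using sets_eq_imp_space_eq[OF sets] h subspace_Ker[OF h] by simp
  qed
  have "measure (\<mu> \<kappa>) ?E = measure (Haar \<kappa>) (Ker -` ?E \<inter> space (Haar \<kappa>))"
    unfolding \<mu>_def by (intro measure_distr Ker openin_borel_of_topology openin_dim_Int_V)
  also have "\<dots> = real (card ?T) / (real q ^ \<kappa>) ^ n"
    unfolding vimage assms(1)
    by (rule measure_UN_cyl[OF Haar_is_normalized_Haar]) (auto simp: tuples_of_rank_def)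
  also have "real (card ?T) = s q n * (\<Prod>i<r. real q ^ \<kappa> - real q ^ i) / (s q r * s q k)"
    using fs.card_tuples_of_rank[OF subspace_V[of \<kappa>] finite_V assms(1) q, of n r] nz
    by (simp add: nk card_V field_simps flip: assms(1))
  \<comment> \<open>The assumption \<open>n - k \<le> \<kappa>\<close> enters here: it makes
    \<open>\<kappa> - r\<close> a genuine difference.\<close>
  also have "(\<Prod>i<r. real q ^ \<kappa> - real q ^ i)
      = real q powr (real r * (real r - 1) / 2) * s q \<kappa> / s q (\<kappa> - r)"
    using prod_power_diff_eq_s[of q r \<kappa>] q assms(3) nz[of "\<kappa> - r"]
    by (simp add: r_def eq_divide_eq)
  also have "(real q ^ \<kappa>) ^ n = real q powr (real \<kappa> * real n)"
    using q by (simp add: powr_realpow flip: power_mult of_nat_mult)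
  also have "s q n * (real q powr (real r * (real r - 1) / 2) * s q \<kappa> / s q (\<kappa> - r))
      / (s q r * s q k) / real q powr (real \<kappa> * real n)
    = real q powr (real r * (real r - 1) / 2 - real \<kappa> * real n)
      * (s q \<kappa> * s q n / (s q r * s q (\<kappa> - r) * s q k))"
    by (simp add: powr_diff mult_ac)
  also have "real r = real n - real k" by (simp add: nk)
  finally show ?thesis by (simp add: r_def)
qed

end
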